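(* Let $H \leq E$ be a subgroup of a group $E$. Then: (1) There exists a map $p : E \to H$ such that $p(1) = 1$ and $p(hx) = h\,p(x)$ for all $h\in H$, $x\in E$. (2) For any map $p : E \to H$ as in (1), define $S = S_p := p^{-1}(1) = \{x\in E \mid p(x) = 1\}$. Then the multiplication map $\varphi : H\times S \to E$, $\varphi(h,s) := hs$ for all $h\in H$, $s\in S$, is bijective, with inverse given for any $x\in E$ by $\varphi^{-1} : E \to H\times S$, $\varphi^{-1}(x) = \bigl(p(x),\, p(x)^{-1}x\bigr)$. (3) For $p$ and $S$ as in (1) and (2), there exist four maps $\triangleright : S\times H \to H$, $\triangleleft : S\times H\to S$, $f : S\times S\to H$ and $\ast : S\times S\to S$ given by the formulas $$ s\triangleright h := p(sh), \qquad s\triangleleft h := p(sh)^{-1}sh, \qquad f(s_1,s_2) := p(s_1s_2), \qquad s_1\ast s_2 := p(s_1s_2)^{-1}s_1s_2 $$ for all $s,s_1,s_2\in S$ and $h\in H$. Using these maps, the unique group structure $\cdot$ on the set $H\times S$ such that $\varphi : (H\times S,\cdot)\to E$ is an isomorphism of groups is given by $$ (h_1,s_1)\cdot(h_2,s_2) := \Bigl( h_1\,(s_1\triangleright h_2)\,f(s_1\triangleleft h_2,\, s_2),\ (s_1\triangleleft h_2)\ast s_2\Bigr) $$ for all $h_1,h_2\in H$ and $s_1,s_2\in S$.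
   Context: Groups are written multiplicatively with unit $1$. *)

theory Defs
  imports "HOL-Algebra.Algebra"
begin

definition unital_left_equivariant :: "('a, 'm) monoid_scheme \<Rightarrow> 'a set \<Rightarrow> ('a \<Rightarrow> 'a) \<Rightarrow> bool" where
  "unital_left_equivariant E H p \<longleftrightarrow>
     p \<in> carrier E \<rightarrow> H \<and>
     p \<one>\<^bsub>E\<^esub> = \<one>\<^bsub>E\<^esub> \<and>
     (\<forall>h\<in>H. \<forall>x\<in>carrier E. p (h \<otimes>\<^bsub>E\<^esub> x) = h \<otimes>\<^bsub>E\<^esub> p x)"

definition unit_fibre :: "('a, 'm) monoid_scheme \<Rightarrow> ('a \<Rightarrow> 'a) \<Rightarrow> 'a set" where
  "unit_fibre E p = {x \<in> carrier E. p x = \<one>\<^bsub>E\<^esub>}"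

definition mult_map :: "('a, 'm) monoid_scheme \<Rightarrow> 'a \<times> 'a \<Rightarrow> 'a" where
  "mult_map E = (\<lambda>(h, s). h \<otimes>\<^bsub>E\<^esub> s)"

text \<open>The four maps are \<open>s \<triangleright> h\<close>, \<open>s \<triangleleft> h\<close>, \<open>f(s\<^sub>1, s\<^sub>2)\<close> and \<open>s\<^sub>1 * s\<^sub>2\<close>, in this order.\<close>

definition right_tri :: "('a, 'm) monoid_scheme \<Rightarrow> ('a \<Rightarrow> 'a) \<Rightarrow> 'a \<Rightarrow> 'a \<Rightarrow> 'a" where
  "right_tri E p s h = p (s \<otimes>\<^bsub>E\<^esub> h)"

definition left_tri :: "('a, 'm) monoid_scheme \<Rightarrow> ('a \<Rightarrow> 'a) \<Rightarrow> 'a \<Rightarrow> 'a \<Rightarrow> 'a" where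
  "left_tri E p s h = inv\<^bsub>E\<^esub> (p (s \<otimes>\<^bsub>E\<^esub> h)) \<otimes>\<^bsub>E\<^esub> s \<otimes>\<^bsub>E\<^esub> h"

definition cocyc :: "('a, 'm) monoid_scheme \<Rightarrow> ('a \<Rightarrow> 'a) \<Rightarrow> 'a \<Rightarrow> 'a \<Rightarrow> 'a" where
  "cocyc E p s\<^sub>1 s\<^sub>2 = p (s\<^sub>1 \<otimes>\<^bsub>E\<^esub> s\<^sub>2)"

definition star_op :: "('a, 'm) monoid_scheme \<Rightarrow> ('a \<Rightarrow> 'a) \<Rightarrow> 'a \<Rightarrow> 'a \<Rightarrow> 'a" where
  "star_op E p s\<^sub>1 s\<^sub>2 = inv\<^bsub>E\<^esub> (p (s\<^sub>1 \<otimes>\<^bsub>E\<^esub> s\<^sub>2)) \<otimes>\<^bsub>E\<^esub> s\<^sub>1 \<otimes>\<^bsub>E\<^esub> s\<^sub>2"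

definition pair_mult :: "('a, 'm) monoid_scheme \<Rightarrow> ('a \<Rightarrow> 'a) \<Rightarrow> 'a \<times> 'a \<Rightarrow> 'a \<times> 'a \<Rightarrow> 'a \<times> 'a" where
  "pair_mult E p = (\<lambda>(h\<^sub>1, s\<^sub>1) (h\<^sub>2, s\<^sub>2).
     (h\<^sub>1 \<otimes>\<^bsub>E\<^esub> right_tri E p s\<^sub>1 h\<^sub>2 \<otimes>\<^bsub>E\<^esub> cocyc E p (left_tri E p s\<^sub>1 h\<^sub>2) s\<^sub>2,
      star_op E p (left_tri E p s\<^sub>1 h\<^sub>2) s\<^sub>2))"

text \<open>The monoid record carries a unit; \<open>(1, 1)\<close> is the preimage of \<open>1\<close> under \<open>mult_map\<close>.\<close>

definition pair_group :: "('a, 'm) monoid_scheme \<Rightarrow> 'a set \<Rightarrow> ('a \<Rightarrow> 'a) \<Rightarrow> ('a \<times> 'a) monoid" where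
  "pair_group E H p =
     \<lparr>carrier = H \<times> unit_fibre E p, monoid.mult = pair_mult E p, one = (\<one>\<^bsub>E\<^esub>, \<one>\<^bsub>E\<^esub>)\<rparr>"

end

theory Submission
  imports Defs
begin

text \<open>An equivariant map \<open>p\<close> amounts to a choice of representatives, one in each right coset
  \<open>H x\<close>, with \<open>\<one>\<close> representing \<open>H\<close> itself: given representatives \<open>r\<close>, put \<open>p x = x r\<inverse>\<close>,
  and conversely \<open>S = p\<inverse>(\<one>)\<close> is the set of representatives.  The unique factorization of
  an element as an element of \<open>H\<close> times a representative is then \<open>x = p x \<cdot> (p x)\<inverse> x\<close>; this is
  the bijectivity of \<open>\<phi>\<close>.

  The multiplication on \<open>H \<times> S\<close> comes from refactoring a product twice.  In
  \<open>h\<^sub>1 s\<^sub>1 h\<^sub>2 s\<^sub>2\<close> the middle is \<open>s\<^sub>1 h\<^sub>2 = (s\<^sub>1 \<triangleright> h\<^sub>2) (s\<^sub>1 \<triangleleft> h\<^sub>2)\<close>, after which the two trailing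
  elements of \<open>S\<close> multiply as \<open>s t = f(s, t) (s * t)\<close>.  So \<open>\<phi>\<close> carries the given formula
  to the product of \<open>E\<close> (lemma \<open>mult_map_pair_mult\<close>).  Since \<open>\<phi>\<close> is injective, this
  determines the structure, and the group axioms are pulled back from \<open>E\<close>
  (lemma \<open>group_pullback\<close>).\<close>

text \<open>Each group axiom is an equation or an existence statement whose image under \<open>f\<close> holds
  in the target group, so a multiplicative bijection reflects it.\<close>

lemma group_pullback:
  assumes "group E"
    and bij: "bij_betw f (carrier G) (carrier E)"
    and closed: "\<And>a b. \<lbrakk>a \<in> carrier G; b \<in> carrier G\<rbrakk> \<Longrightarrow> a \<otimes>\<^bsub>G\<^esub> b \<in> carrier G"
    and hom: "\<And>a b. \<lbrakk>a \<in> carrier G; b \<in> carrier G\<rbrakk> \<Longrightarrow> f (a \<otimes>\<^bsub>G\<^esub> b) = f a \<otimes>\<^bsub>E\<^esub> f b"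
    and one: "\<one>\<^bsub>G\<^esub> \<in> carrier G" "f \<one>\<^bsub>G\<^esub> = \<one>\<^bsub>E\<^esub>"
  shows "group G"
proof -
  interpret E: group E by fact
  have inj: "a = b" if "f a = f b" "a \<in> carrier G" "b \<in> carrier G" for a b
    using bij that by (auto simp: bij_betw_def dest: inj_onD)
  have f_closed: "f a \<in> carrier E" if "a \<in> carrier G" for a
    using bij that by (auto simp: bij_betw_def)
  show ?thesis
  proof (rule groupI)
    fix x y z assume "x \<in> carrier G" "y \<in> carrier G" "z \<in> carrier G"
    then show "x \<otimes>\<^bsub>G\<^esub> y \<otimes>\<^bsub>G\<^esub> z = x \<otimes>\<^bsub>G\<^esub> (y \<otimes>\<^bsub>G\<^esub> z)"
      by (intro inj) (simp_all add: closed hom f_closed E.m_assoc)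
  next
    fix x assume "x \<in> carrier G"
    then show "\<one>\<^bsub>G\<^esub> \<otimes>\<^bsub>G\<^esub> x = x"
      by (intro inj) (simp_all add: closed hom f_closed one)
  next
    fix x assume x: "x \<in> carrier G"
    then obtain y where "y \<in> carrier G" "f y = inv\<^bsub>E\<^esub> f x"
      using bij f_closed E.inv_closed by (metis bij_betw_imp_surj_on imageE)
    with x show "\<exists>y\<in>carrier G. y \<otimes>\<^bsub>G\<^esub> x = \<one>\<^bsub>G\<^esub>"
      by (intro bexI[of _ y] inj) (simp_all add: closed hom f_closed one)
  qed (simp_all add: closed one)
qed

text \<open>The coset of \<open>\<one>\<close> is represented by \<open>\<one>\<close> itself, which gives \<open>p \<one> = \<one>\<close>.  As \<open>h x\<close> and \<open>x\<close>
  share their coset, hence its representative \<open>r\<close>, equivariance of \<open>x \<mapsto> x r\<inverse>\<close> is associativity.\<close>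

lemma ex_unital_left_equivariant:
  fixes E (structure)
  assumes "group E" and "subgroup H E"
  shows "\<exists>p. unital_left_equivariant E H p"
proof -
  interpret group E by fact
  interpret H: subgroup H E by fact
  define r where "r = (\<lambda>C. if \<one> \<in> C then \<one> else (SOME y. y \<in> C))"
  define p where "p = (\<lambda>x. x \<otimes> inv (r (H #> x)))"
  have r_mem: "r (H #> x) \<in> H #> x" if "x \<in> carrier E" for x
    using someI[of "\<lambda>y. y \<in> H #> x", OF rcos_self[OF that H.subgroup_axioms]]
    by (simp add: r_def)
  have r_closed: "r (H #> x) \<in> carrier E" if "x \<in> carrier E" for x
    using r_mem[OF that] r_coset_subset_G[OF H.subset that] by blast
  have p_mem: "p x \<in> H" if x: "x \<in> carrier E" for x
  proof -
    obtain h where h: "h \<in> H" "r (H #> x) = h \<otimes> x"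
      using r_mem[OF x] unfolding r_coset_def by blast
    have "p x = inv h"
      using h x by (simp add: p_def inv_mult_group m_assoc[symmetric])
    then show ?thesis using h by simp
  qed
  have p_one: "p \<one> = \<one>"
    by (simp add: p_def r_def coset_mult_one[OF H.subset])
  have "p (h \<otimes> x) = h \<otimes> p x" if h: "h \<in> H" and x: "x \<in> carrier E" for h x
  proof -
    have "H #> (h \<otimes> x) = H #> x"
      using h x by (simp add: coset_mult_assoc[symmetric] H.subset
          coset_join2[OF _ H.subgroup_axioms])
    then show ?thesis
      using h x r_closed by (simp add: p_def m_assoc)
  qed
  then show ?thesis
    using p_mem p_one unfolding unital_left_equivariant_def by blast
qed

locale equivariant_retraction = group E + H: subgroup H E
  for E :: "('a, 'm) monoid_scheme" (structure) and H and p :: "'a \<Rightarrow> 'a" +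
  assumes equivariant: "unital_left_equivariant E H p"
begin

abbreviation S where "S \<equiv> unit_fibre E p"

lemma p_mem [simp]: "x \<in> carrier E \<Longrightarrow> p x \<in> H"
  using equivariant by (auto simp: unital_left_equivariant_def)

lemma p_closed [simp]: "x \<in> carrier E \<Longrightarrow> p x \<in> carrier E"
  by (rule H.mem_carrier) simp

lemma p_one [simp]: "p \<one> = \<one>"
  using equivariant by (auto simp: unital_left_equivariant_def)

lemma p_mult: "\<lbrakk>h \<in> H; x \<in> carrier E\<rbrakk> \<Longrightarrow> p (h \<otimes> x) = h \<otimes> p x"
  using equivariant by (auto simp: unital_left_equivariant_def)

lemma mem_S_I: "\<lbrakk>x \<in> carrier E; p x = \<one>\<rbrakk> \<Longrightarrow> x \<in> S"
  by (simp add: unit_fibre_def)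

lemma mem_S_D [simp]: "s \<in> S \<Longrightarrow> s \<in> carrier E" "s \<in> S \<Longrightarrow> p s = \<one>"
  by (simp_all add: unit_fibre_def)

lemma p_mult_S: "\<lbrakk>h \<in> H; s \<in> S\<rbrakk> \<Longrightarrow> p (h \<otimes> s) = h"
  by (simp add: p_mult)

lemma remainder_mem_S: "x \<in> carrier E \<Longrightarrow> inv (p x) \<otimes> x \<in> S"
  by (rule mem_S_I) (simp_all add: p_mult)

lemma mult_remainder: "x \<in> carrier E \<Longrightarrow> p x \<otimes> (inv (p x) \<otimes> x) = x"
  by (simp add: m_assoc[symmetric])

text \<open>The factor in \<open>H\<close> can be read off from the product, as \<open>p (h s) = h p s = h\<close>, and it
  determines the other one.\<close>

lemma bij_mult_map: "bij_betw (mult_map E) (H \<times> S) (carrier E)"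
  by (rule bij_betw_byWitness[where f' = "\<lambda>x. (p x, inv (p x) \<otimes> x)"])
    (auto simp: mult_map_def p_mult_S remainder_mem_S mult_remainder m_assoc[symmetric])

lemma inv_into_mult_map:
  assumes "x \<in> carrier E"
  shows "inv_into (H \<times> S) (mult_map E) x = (p x, inv (p x) \<otimes> x)"
  using assms bij_mult_map
  by (intro inv_into_f_eq)
    (auto simp: bij_betw_def mult_map_def remainder_mem_S mult_remainder)

lemma right_tri_mem: "\<lbrakk>s \<in> S; h \<in> H\<rbrakk> \<Longrightarrow> right_tri E p s h \<in> H"
  by (simp add: right_tri_def)

lemma left_tri_mem: "\<lbrakk>s \<in> S; h \<in> H\<rbrakk> \<Longrightarrow> left_tri E p s h \<in> S"
  using remainder_mem_S[of "s \<otimes> h"] by (simp add: left_tri_def m_assoc)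

lemma cocyc_mem: "\<lbrakk>s \<in> S; t \<in> S\<rbrakk> \<Longrightarrow> cocyc E p s t \<in> H"
  by (simp add: cocyc_def)

lemma star_op_mem: "\<lbrakk>s \<in> S; t \<in> S\<rbrakk> \<Longrightarrow> star_op E p s t \<in> S"
  using remainder_mem_S[of "s \<otimes> t"] by (simp add: star_op_def m_assoc)

lemma right_tri_left_tri:
  "\<lbrakk>s \<in> S; h \<in> H\<rbrakk> \<Longrightarrow> right_tri E p s h \<otimes> left_tri E p s h = s \<otimes> h"
  using mult_remainder[of "s \<otimes> h"] by (simp add: right_tri_def left_tri_def m_assoc)

lemma cocyc_star_op:
  "\<lbrakk>s \<in> S; t \<in> S\<rbrakk> \<Longrightarrow> cocyc E p s t \<otimes> star_op E p s t = s \<otimes> t"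
  using mult_remainder[of "s \<otimes> t"] by (simp add: cocyc_def star_op_def m_assoc)

lemma pair_mult_mem:
  "\<lbrakk>a \<in> H \<times> S; b \<in> H \<times> S\<rbrakk> \<Longrightarrow> pair_mult E p a b \<in> H \<times> S"
  by (auto simp: pair_mult_def right_tri_mem left_tri_mem cocyc_mem star_op_mem)

text \<open>Both crossings, of \<open>S\<close> past \<open>H\<close> and of \<open>S\<close> with \<open>S\<close>, are factorizations in \<open>E\<close>, so
  undoing them recovers the product of \<open>E\<close>.\<close>

lemma mult_map_pair_mult:
  assumes "a \<in> H \<times> S" and "b \<in> H \<times> S"
  shows "mult_map E (pair_mult E p a b) = mult_map E a \<otimes> mult_map E b"
proof -
  obtain h s k t where ab: "a = (h, s)" "b = (k, t)"
    and [simp]: "h \<in> H" "s \<in> S" "k \<in> H" "t \<in> S"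
    using assms by auto
  define r l where "r = right_tri E p s k" and "l = left_tri E p s k"
  have [simp]: "r \<in> H" "l \<in> S"
    by (simp_all add: r_def l_def right_tri_mem left_tri_mem)
  have [simp]: "cocyc E p l t \<in> carrier E" "star_op E p l t \<in> carrier E"
    by (simp_all add: cocyc_mem H.mem_carrier star_op_mem)
  have "mult_map E (pair_mult E p a b) = h \<otimes> r \<otimes> (cocyc E p l t \<otimes> star_op E p l t)"
    by (simp add: ab mult_map_def pair_mult_def r_def[symmetric] l_def[symmetric] m_assoc)
  also have "\<dots> = h \<otimes> (r \<otimes> l) \<otimes> t"
    by (simp add: cocyc_star_op m_assoc)
  also have "\<dots> = h \<otimes> (s \<otimes> k) \<otimes> t"
    by (simp add: r_def l_def right_tri_left_tri)
  also have "\<dots> = mult_map E a \<otimes> mult_map E b"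
    by (simp add: ab mult_map_def m_assoc)
  finally show ?thesis .
qed

lemma one_mem_S [simp]: "\<one> \<in> S"
  by (rule mem_S_I) simp_all

lemma pair_group_simps [simp]:
  "carrier (pair_group E H p) = H \<times> S"
  "a \<otimes>\<^bsub>pair_group E H p\<^esub> b = pair_mult E p a b"
  "\<one>\<^bsub>pair_group E H p\<^esub> = (\<one>, \<one>)"
  by (simp_all add: pair_group_def)

lemma group_pair_group: "group (pair_group E H p)"
  by (rule group_pullback[where f = "mult_map E", OF is_group])
    (simp_all only: pair_group_simps bij_mult_map pair_mult_mem mult_map_pair_mult,
      simp_all add: mult_map_def)

lemma mult_map_iso: "mult_map E \<in> iso (pair_group E H p) E"
  using bij_mult_map mult_map_pair_mult
  unfolding iso_def hom_def by (auto simp: bij_betw_def)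

text \<open>An injective homomorphism into \<open>E\<close> leaves no freedom for the product or the unit of its
  source.\<close>

lemma pair_group_unique:
  fixes G :: "('a \<times> 'a) monoid"
  assumes car: "carrier G = H \<times> S" and "group G" and iso: "mult_map E \<in> iso G E"
  shows "\<one>\<^bsub>G\<^esub> = \<one>\<^bsub>pair_group E H p\<^esub>"
    and "\<lbrakk>a \<in> carrier G; b \<in> carrier G\<rbrakk> \<Longrightarrow> a \<otimes>\<^bsub>G\<^esub> b = a \<otimes>\<^bsub>pair_group E H p\<^esub> b"
proof -
  interpret G: group G by fact
  have hom: "mult_map E \<in> hom G E"
    using iso by (simp add: iso_def)
  have inj: "inj_on (mult_map E) (H \<times> S)"
    using bij_mult_map by (rule bij_betw_imp_inj_on)
  have "mult_map E \<one>\<^bsub>G\<^esub> = mult_map E (\<one>, \<one>)"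
    using hom_one[OF hom \<open>group G\<close> is_group] by (simp add: mult_map_def)
  then show "\<one>\<^bsub>G\<^esub> = \<one>\<^bsub>pair_group E H p\<^esub>"
    using G.one_closed by (simp add: inj_on_eq_iff[OF inj] car)
  assume ab: "a \<in> carrier G" "b \<in> carrier G"
  have "mult_map E (a \<otimes>\<^bsub>G\<^esub> b) = mult_map E (pair_mult E p a b)"
    using hom_mult[OF hom ab] ab mult_map_pair_mult unfolding car by simp
  then have "a \<otimes>\<^bsub>G\<^esub> b = pair_mult E p a b"
    using G.m_closed[OF ab] pair_mult_mem[OF ab[unfolded car]] unfolding car
    by (rule inj_onD[OF inj])
  then show "a \<otimes>\<^bsub>G\<^esub> b = a \<otimes>\<^bsub>pair_group E H p\<^esub> b"
    by simp
qed

end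

theorem theorem2p1:
  fixes E :: "('a, 'm) monoid_scheme" and H :: "'a set"
  assumes "group E" and "subgroup H E"
  shows "(\<exists>p. unital_left_equivariant E H p) \<and>
    (\<forall>p. unital_left_equivariant E H p \<longrightarrow>
       bij_betw (mult_map E) (H \<times> unit_fibre E p) (carrier E) \<and>
       (\<forall>x\<in>carrier E.
          (p x, inv\<^bsub>E\<^esub> (p x) \<otimes>\<^bsub>E\<^esub> x) \<in> H \<times> unit_fibre E p \<and>
          inv_into (H \<times> unit_fibre E p) (mult_map E) x = (p x, inv\<^bsub>E\<^esub> (p x) \<otimes>\<^bsub>E\<^esub> x))) \<and>
    (\<forall>p. unital_left_equivariant E H p \<longrightarrow>
       right_tri E p \<in> unit_fibre E p \<rightarrow> H \<rightarrow> H \<and>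
       left_tri E p \<in> unit_fibre E p \<rightarrow> H \<rightarrow> unit_fibre E p \<and>
       cocyc E p \<in> unit_fibre E p \<rightarrow> unit_fibre E p \<rightarrow> H \<and>
       star_op E p \<in> unit_fibre E p \<rightarrow> unit_fibre E p \<rightarrow> unit_fibre E p \<and>
       group (pair_group E H p) \<and>
       mult_map E \<in> iso (pair_group E H p) E \<and>
       (\<forall>G :: ('a \<times> 'a) monoid.
          carrier G = H \<times> unit_fibre E p \<and> group G \<and> mult_map E \<in> iso G E \<longrightarrow>
            \<one>\<^bsub>G\<^esub> = \<one>\<^bsub>pair_group E H p\<^esub> \<and>
            (\<forall>a\<in>carrier G. \<forall>b\<in>carrier G. a \<otimes>\<^bsub>G\<^esub> b = a \<otimes>\<^bsub>pair_group E H p\<^esub> b)))"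
proof (intro conjI[OF ex_unital_left_equivariant[OF assms]] conjI allI impI)
  fix p assume "unital_left_equivariant E H p"
  then interpret equivariant_retraction E H p
    using assms by (simp add: equivariant_retraction_def equivariant_retraction_axioms_def)
  show "bij_betw (mult_map E) (H \<times> S) (carrier E)"
    by (rule bij_mult_map)
  show "\<forall>x\<in>carrier E. (p x, inv\<^bsub>E\<^esub> (p x) \<otimes>\<^bsub>E\<^esub> x) \<in> H \<times> S \<and>
      inv_into (H \<times> S) (mult_map E) x = (p x, inv\<^bsub>E\<^esub> (p x) \<otimes>\<^bsub>E\<^esub> x)"
    by (simp add: remainder_mem_S inv_into_mult_map)
next
  fix p assume "unital_left_equivariant E H p"
  then interpret equivariant_retraction E H p
    using assms by (simp add: equivariant_retraction_def equivariant_retraction_axioms_def)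
  show "right_tri E p \<in> S \<rightarrow> H \<rightarrow> H" "left_tri E p \<in> S \<rightarrow> H \<rightarrow> S"
    "cocyc E p \<in> S \<rightarrow> S \<rightarrow> H" "star_op E p \<in> S \<rightarrow> S \<rightarrow> S"
    by (simp_all add: Pi_def right_tri_mem left_tri_mem cocyc_mem star_op_mem)
  show "group (pair_group E H p)" "mult_map E \<in> iso (pair_group E H p) E"
    by (rule group_pair_group mult_map_iso)+
  fix G :: "('a \<times> 'a) monoid"
  assume "carrier G = H \<times> S \<and> group G \<and> mult_map E \<in> iso G E"
  then show "\<one>\<^bsub>G\<^esub> = \<one>\<^bsub>pair_group E H p\<^esub>"
    and "\<forall>a\<in>carrier G. \<forall>b\<in>carrier G. a \<otimes>\<^bsub>G\<^esub> b = a \<otimes>\<^bsub>pair_group E H p\<^esub> b"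
    using pair_group_unique[of G] by blast+
qed

end
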